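(* Let $n$ be a positive integer. The grammic monoid of rank $n$ is compatible with restriction to alphabet intervals, packing, standardisation, and Sch\"utzenberger involution. That is, for all $u,v\in[n]^*$: \begin{itemize} \item $u\equiv_{{\rm gram},n} v$ if and only if $u_{\mathcal{I}}\equiv_{{\rm gram},n} v_{\mathcal{I}}$ for all subintervals $\mathcal{I}$ of $[n]$; \item $u\equiv_{{\rm gram},n} v$ if and only if ${\rm pack}(u)\equiv_{{\rm gram},n}{\rm pack}(v)$ and ${\rm cont}(u)={\rm cont}(v)$; \item $u\equiv_{{\rm gram},n} v$ if and only if ${\rm cont}(u)={\rm cont}(v)$ and ${\rm std}(u)\equiv_{{\rm gram},k}{\rm std}(v)$, where $k=|u|=|v|$ is the common length; \item $u\equiv_{{\rm gram},n} v$ if and only if $u^*\equiv_{{\rm gram},n} v^*$. \end{itemize}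
   Context: For $k\geq 0$ write $[k]=\{1<2<\cdots<k\}$, $[k]^*$ for the free monoid on $[k]$, and $\mathbb{N}_0$ for the non-negative integers. For a word $u$, $|u|$ is its length and $|u|_a$ the number of occurrences of the letter $a$. Grammic congruence of rank $k$: each letter $a\in[k]$ acts on $\mathbb{N}_0^k$ on the right: for $\gamma\in\mathbb{N}_0^k$ let $t=\min\{s\in[k]: s>a,\ \gamma_s>0\}$ if this set is non-empty; then $\gamma\cdot a=\gamma+e_a-e_t$ if $t$ is defined, and $\gamma\cdot a=\gamma+e_a$ otherwise, where $e_i$ is the $i$th standard basis vector. This extends to words by $\gamma\cdot\varepsilon=\gamma$ and $\gamma\cdot(w_1\cdots w_r)=(\cdots(\gamma\cdot w_1)\cdots)\cdot w_r$. For $u,v\in[k]^*$, $u\equiv_{{\rm gram},k}v$ means $\gamma\cdot u=\gamma\cdot v$ for all $\gamma\in\mathbb{N}_0^k$. The grammic monoid of rank $n$ is $[n]^*/\equiv_{{\rm gram},n}$. A subset $\mathcal{I}$ of $[n]$ is a subinterval if $b_1<a<b_2$ with $b_1,b_2\in\mathcal{I}$ and $a\in[n]$ implies $a\in\mathcal{I}$. For $u\in[n]^*$ whose set of occurring letters (support) is $\{a_1<\cdots<a_m\}$: \begin{itemize} \item ${\rm cont}(u)$ is the function mapping each $a\in[n]$ to $|u|_a$; \item $u_{\mathcal{I}}$ is the word obtained from $u$ by deleting each symbol not in $\mathcal{I}$; \item ${\rm pack}(u)\in[m]^*\subseteq[n]^*$ is obtained from $u$ by replacing each letter $a_i$ by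 $i$; \item ${\rm std}(u)\in[|u|]^*$ is the permutation word obtained by replacing, for each $1\le i\le m$, the $j$th occurrence of $a_i$ in $u$ (reading from left to right) by $j+\sum_{t=1}^{i-1}|u|_{a_t}$; \item $u^*\in[n]^*$ is the word obtained from $u$ by replacing each letter $i$ by $n-i+1$ and then reversing the word (Sch\"utzenberger involution). \end{itemize} *)

theory Defs
  imports Main "HOL-Library.FuncSet"
begin

definition alphabet :: "nat \<Rightarrow> nat set" where
  "alphabet k = {1..k}"

definition words :: "nat \<Rightarrow> nat list set" where
  "words k = lists (alphabet k)"

text \<open>Vectors of length k over the non-negative integers are functions on all natural
  numbers that vanish outside the index set 1, ..., k.\<close>

definition vecs :: "nat \<Rightarrow> (nat \<Rightarrow> nat) set" where
  "vecs k = {\<gamma>. \<forall>i. i \<notin> alphabet k \<longrightarrow> \<gamma> i = 0}"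

text \<open>In the second branch t differs from a and the entry of \<open>\<gamma>\<close> at t is positive, so the
  subtraction is not truncated.\<close>

definition letter_act :: "nat \<Rightarrow> (nat \<Rightarrow> nat) \<Rightarrow> nat \<Rightarrow> (nat \<Rightarrow> nat)" where
  "letter_act k \<gamma> a =
     (let S = {s \<in> alphabet k. a < s \<and> 0 < \<gamma> s} in
      if S = {} then \<gamma>(a := \<gamma> a + 1)
      else (let t = Min S in \<gamma>(a := \<gamma> a + 1, t := \<gamma> t - 1)))"

definition word_act :: "nat \<Rightarrow> (nat \<Rightarrow> nat) \<Rightarrow> nat list \<Rightarrow> (nat \<Rightarrow> nat)" where
  "word_act k = foldl (letter_act k)"

definition gram_cong :: "nat \<Rightarrow> nat list \<Rightarrow> nat list \<Rightarrow> bool" where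
  "gram_cong k u v \<longleftrightarrow>
     u \<in> words k \<and> v \<in> words k \<and> (\<forall>\<gamma> \<in> vecs k. word_act k \<gamma> u = word_act k \<gamma> v)"

definition subinterval :: "nat \<Rightarrow> nat set \<Rightarrow> bool" where
  "subinterval n I \<longleftrightarrow>
     I \<subseteq> alphabet n \<and>
     (\<forall>b\<^sub>1 \<in> I. \<forall>b\<^sub>2 \<in> I. \<forall>a \<in> alphabet n. b\<^sub>1 < a \<and> a < b\<^sub>2 \<longrightarrow> a \<in> I)"

definition content :: "nat \<Rightarrow> nat list \<Rightarrow> nat \<Rightarrow> nat" where
  "content n u = (\<lambda>a \<in> alphabet n. count_list u a)"

definition restr_word :: "nat set \<Rightarrow> nat list \<Rightarrow> nat list" where
  "restr_word I u = filter (\<lambda>a. a \<in> I) u"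

text \<open>The i-th smallest letter of the support is the letter a having exactly i support
  letters b with \<open>b \<le> a\<close>.\<close>

definition pack :: "nat list \<Rightarrow> nat list" where
  "pack u = map (\<lambda>a. card {b \<in> set u. b \<le> a}) u"

text \<open>At (0-based) position p stands the j-th occurrence of its letter a, where j counts the
  occurrences of a among the first p + 1 letters; the sum runs over the support letters
  smaller than a.\<close>

definition standardise :: "nat list \<Rightarrow> nat list" where
  "standardise u =
     map (\<lambda>p. count_list (take (Suc p) u) (u ! p) + (\<Sum>b \<in> {b \<in> set u. b < u ! p}. count_list u b))
       [0..<length u]"

definition schuetzenberger :: "nat \<Rightarrow> nat list \<Rightarrow> nat list" where
  "schuetzenberger n u = rev (map (\<lambda>i. n - i + 1) u)"

end

theory Submission
  imports Defs "HOL-Library.Sublist"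
begin

text \<open>In terms of the partial sums \<open>\<Gamma>\<^sub>i = \<gamma>\<^sub>1 + \<dots> + \<gamma>\<^sub>i\<close> a letter \<open>a\<close> acts tropically linearly: it
  replaces \<open>\<Gamma>\<^sub>i\<close> by \<open>max \<Gamma>\<^sub>i (\<Gamma>\<^sub>a + 1)\<close> for \<open>i \<ge> a\<close> and fixes the other entries. Hence a word \<open>u\<close> maps
  \<open>\<Gamma>\<^sub>i\<close> to the maximum over \<open>j \<le> i\<close> of \<open>\<Gamma>\<^sub>j + L\<close>, where \<open>L\<close> is the length of a longest
  nondecreasing subsequence of \<open>u\<close> with letters in \<open>[j, i]\<close>, and by a choice of \<open>\<gamma>\<close> concentrated in one
  large entry these lengths can be recovered from the action. So two words are congruent iff they
  have the same such lengths for all intervals. Restriction, packing and the involution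
  permute or restrict the intervals. For standardisation, the intervals that are unions of blocks
  of equal letters correspond to intervals of \<open>u\<close>, and shrinking an interval by one letter inside
  a block changes the length in a way determined by the other lengths.\<close>

section \<open>Longest nondecreasing subsequences\<close>

text \<open>Arbitrary letter sets are allowed, so that preimages and intersections of intervals can
  be inserted directly.\<close>

definition lnds :: "nat set \<Rightarrow> nat list \<Rightarrow> nat" where
  "lnds S u = Max (length ` {s. subseq s u \<and> sorted s \<and> set s \<subseteq> S})"

text \<open>The maximum runs over a finite set that contains the empty list. Equalities of lengths
  are later proved by comparing all lower bounds \<open>m\<close> through this criterion.\<close>

lemma le_lnds_iff:
  "m \<le> lnds S u \<longleftrightarrow> (\<exists>s. subseq s u \<and> sorted s \<and> set s \<subseteq> S \<and> m \<le> length s)"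
proof -
  let ?A = "{s. subseq s u \<and> sorted s \<and> set s \<subseteq> S}"
  have "finite ?A"
    by (rule finite_subset[of _ "set (subseqs u)"]) (use in_set_subseqs in blast, simp)
  moreover have "[] \<in> ?A" by simp
  ultimately show ?thesis
    unfolding lnds_def by (subst Max_ge_iff) (blast, blast, auto)
qed

lemma length_le_lnds:
  assumes "subseq s u" "sorted s" "set s \<subseteq> S"
  shows "length s \<le> lnds S u"
  using assms le_lnds_iff by blast

lemma obtain_lnds:
  obtains s where "subseq s u" "sorted s" "set s \<subseteq> S" "length s = lnds S u"
  using le_lnds_iff[of "lnds S u" S u] length_le_lnds
  by (metis le_antisym order_refl)

lemma eq_by_le_iff: "(\<And>m. m \<le> a \<longleftrightarrow> m \<le> b) \<Longrightarrow> a = b" for a b :: nat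
  by (meson le_antisym order_refl)

lemma lnds_cong:
  assumes "S \<inter> set u = T \<inter> set u"
  shows "lnds S u = lnds T u"
proof -
  have "set s \<subseteq> S \<longleftrightarrow> set s \<subseteq> T" if "subseq s u" for s
    using assms list_emb_set[OF that] by blast
  then show ?thesis unfolding lnds_def by meson
qed

lemma lnds_mono:
  assumes "S \<inter> set u \<subseteq> T"
  shows "lnds S u \<le> lnds T u"
proof -
  obtain s where s: "subseq s u" "sorted s" "set s \<subseteq> S" "length s = lnds S u"
    by (rule obtain_lnds)
  moreover have "set s \<subseteq> T"
    using assms s(3) list_emb_set[OF s(1)] by blast
  ultimately show ?thesis using length_le_lnds by metis
qed

lemma lnds_le_length: "lnds S u \<le> length u"
  by (metis list_emb_length obtain_lnds)

lemma lnds_empty [simp]: "lnds {} u = 0"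
  by (metis empty_subsetI list.size(3) obtain_lnds set_empty2 subset_antisym)

lemma lnds_filter: "lnds S (filter P u) = lnds {x \<in> S. P x} u"
proof (rule eq_by_le_iff)
  fix m
  have "subseq s (filter P u) \<longleftrightarrow> subseq s u \<and> (\<forall>x\<in>set s. P x)" for s
  proof
    assume s: "subseq s (filter P u)"
    then have "subseq s u"
      using subseq_filter_left subseq_order.trans by blast
    moreover have "P x" if "x \<in> set s" for x
      using list_emb_set[OF s that] by auto
    ultimately show "subseq s u \<and> (\<forall>x\<in>set s. P x)" by blast
  next
    assume "subseq s u \<and> (\<forall>x\<in>set s. P x)"
    then show "subseq s (filter P u)"
      by (metis filter_True subseq_filter)
  qed
  then show "m \<le> lnds S (filter P u) \<longleftrightarrow> m \<le> lnds {x \<in> S. P x} u"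
    unfolding le_lnds_iff by blast
qed

lemma subseq_map_iff: "subseq s (map g w) \<longleftrightarrow> (\<exists>t. subseq t w \<and> s = map g t)"
  unfolding subseq_conv_nths nths_map by blast

lemma sorted_wrt_subseq:
  assumes "subseq s u" "sorted_wrt P u"
  shows "sorted_wrt P s"
  using assms
proof induction
  case (list_emb_Cons2 x y xs ys)
  then show ?case using list_emb_set[OF list_emb_Cons2(2)] by (metis sorted_wrt.simps(2))
qed auto

text \<open>A monotone map can only create sorted subsequences by merging a descent into equal
  letters; \<open>ties\<close> excludes this, so the same subsequences are sorted before and after
  the map.\<close>

lemma lnds_map:
  assumes mono: "mono_on (set w) g"
    and ties: "sorted_wrt (\<lambda>x y. g x = g y \<longrightarrow> x \<le> y) w"
  shows "lnds S (map g w) = lnds (g -` S) w"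
proof (rule eq_by_le_iff)
  fix m
  have srt: "sorted (map g t) \<longleftrightarrow> sorted t" if t: "subseq t w" for t
  proof -
    have sub: "set t \<subseteq> set w" using list_emb_set[OF t] by blast
    have le: "x \<le> y \<longleftrightarrow> g x \<le> g y"
      if "x \<in> set t" "y \<in> set t" "g x = g y \<longrightarrow> x \<le> y" for x y
    proof -
      have "x \<in> set w" "y \<in> set w" using sub that by auto
      then show ?thesis
        using mono_onD[OF mono, of x y] mono_onD[OF mono, of y x] that(3) by linarith
    qed
    have "sorted_wrt (\<lambda>x y. g x = g y \<longrightarrow> x \<le> y) t"
      using sorted_wrt_subseq[OF t ties] .
    then have "t ! i \<le> t ! j \<longleftrightarrow> g (t ! i) \<le> g (t ! j)" if "i < j" "j < length t" for i j
      using that by (intro le) (auto simp: sorted_wrt_iff_nth_less)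
    then show ?thesis
      unfolding sorted_map by (simp add: sorted_wrt_iff_nth_less)
  qed
  have "m \<le> lnds S (map g w) \<longleftrightarrow>
      (\<exists>t. subseq t w \<and> sorted (map g t) \<and> set (map g t) \<subseteq> S \<and> m \<le> length (map g t))"
    unfolding le_lnds_iff subseq_map_iff by blast
  also have "\<dots> \<longleftrightarrow> m \<le> lnds (g -` S) w"
    unfolding le_lnds_iff using srt by (auto simp: image_subset_iff_subset_vimage)
  finally show "m \<le> lnds S (map g w) \<longleftrightarrow> m \<le> lnds (g -` S) w" .
qed

lemma subseq_rev: "subseq s u \<Longrightarrow> subseq (rev s) (rev u)"
proof (induction rule: list_emb.induct)
  case (list_emb_Cons xs ys y)
  then show ?case by (simp add: subseq_rev_drop_many)
qed auto

text \<open>Reversing the word and reversing the order of the letters cancel each other on sorted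
  subsequences.\<close>

lemma lnds_rev_map:
  assumes anti: "\<And>x y. x \<in> set w \<Longrightarrow> y \<in> set w \<Longrightarrow> h x \<le> h y \<longleftrightarrow> y \<le> x"
  shows "lnds S (rev (map h w)) = lnds (h -` S) w"
proof (rule eq_by_le_iff)
  fix m
  have srt: "sorted (rev (map h t)) \<longleftrightarrow> sorted t" if t: "subseq t w" for t
  proof -
    have le: "h x \<le> h y \<longleftrightarrow> y \<le> x" if "x \<in> set t" "y \<in> set t" for x y
      using anti list_emb_set[OF t] that by metis
    have "sorted (rev (map h t)) \<longleftrightarrow> sorted_wrt (\<lambda>x y. h y \<le> h x) t"
      by (simp add: sorted_wrt_rev sorted_wrt_map)
    also have "\<dots> \<longleftrightarrow> sorted t"
      using le by (auto elim!: sorted_wrt_mono_rel[rotated])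
    finally show ?thesis .
  qed
  have sq: "subseq s (rev (map h w)) \<longleftrightarrow> (\<exists>t. subseq t w \<and> s = rev (map h t))" for s
  proof -
    have "subseq s (rev (map h w)) \<longleftrightarrow> subseq (rev s) (map h w)"
      by (metis rev_rev_ident subseq_rev)
    then show ?thesis unfolding subseq_map_iff by (metis rev_rev_ident)
  qed
  have "m \<le> lnds S (rev (map h w)) \<longleftrightarrow>
      (\<exists>t. subseq t w \<and> sorted (rev (map h t)) \<and> set (rev (map h t)) \<subseteq> S \<and>
        m \<le> length (rev (map h t)))"
    unfolding le_lnds_iff sq by blast
  also have "\<dots> \<longleftrightarrow> m \<le> lnds (h -` S) w"
    unfolding le_lnds_iff using srt by (auto simp: image_subset_iff_subset_vimage)
  finally show "m \<le> lnds S (rev (map h w)) \<longleftrightarrow> m \<le> lnds (h -` S) w" .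
qed

lemma lnds_singleton: "lnds {a} u = count_list u a"
proof (rule antisym)
  obtain s where s: "subseq s u" "set s \<subseteq> {a}" "length s = lnds {a} u"
    by (metis obtain_lnds)
  have "filter ((=) a) s = s" using s(2) by (intro filter_True) auto
  then have "subseq s (filter ((=) a) u)"
    using subseq_filter[OF s(1)] by metis
  then show "lnds {a} u \<le> count_list u a"
    using s(3) list_emb_length by (fastforce simp: count_list_eq_length_filter)
next
  have "filter ((=) a) u = replicate (count_list u a) a"
    by (induction u) auto
  then have "subseq (replicate (count_list u a) a) u"
    by (metis subseq_filter_left)
  then show "count_list u a \<le> lnds {a} u"
    using length_le_lnds[of "replicate (count_list u a) a" u "{a}"]
    by (auto simp: set_replicate_conv_if split: if_splits)
qed

text \<open>A sorted subsequence that uses the new last letter is a sorted subsequence of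
  \<open>u\<close> with letters at most \<open>a\<close>, followed by \<open>a\<close>.\<close>

lemma le_lnds_snoc:
  "m \<le> lnds S (u @ [a]) \<longleftrightarrow>
     m \<le> lnds S u \<or> (a \<in> S \<and> m \<le> Suc (lnds (S \<inter> {..a}) u))"
proof (cases m)
  case (Suc k)
  have last: "subseq t [a] \<longleftrightarrow> t = [] \<or> t = [a]" for t
    by (cases t; cases "hd t = a") auto
  have sq: "subseq s (u @ [a]) \<longleftrightarrow> subseq s u \<or> (\<exists>t. subseq t u \<and> s = t @ [a])" for s
    unfolding subseq_append_iff last by (metis append_Nil2)
  have "m \<le> lnds S (u @ [a]) \<longleftrightarrow> m \<le> lnds S u \<or>
      (\<exists>t. subseq t u \<and> sorted (t @ [a]) \<and> set (t @ [a]) \<subseteq> S \<and> m \<le> length (t @ [a]))"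
    unfolding le_lnds_iff sq by blast
  also have "\<dots> \<longleftrightarrow> m \<le> lnds S u \<or> (a \<in> S \<and> k \<le> lnds (S \<inter> {..a}) u)"
    unfolding le_lnds_iff[of k] using Suc by (auto simp: sorted_append)
  finally show ?thesis using Suc by simp
qed simp

section \<open>The action on partial sums\<close>

text \<open>The index 0 is included, but contributes nothing for members of
  \<open>vecs k\<close>.\<close>

definition cum :: "(nat \<Rightarrow> nat) \<Rightarrow> nat \<Rightarrow> nat" where
  "cum \<gamma> i = (\<Sum>l\<le>i. \<gamma> l)"

lemma cum_eqD:
  assumes "\<And>i. cum \<gamma> i = cum \<delta> i"
  shows "\<gamma> = \<delta>"
proof
  fix i
  show "\<gamma> i = \<delta> i"
    using assms[of i] assms[of "i - 1"] by (cases i) (auto simp: cum_def)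
qed

lemma cum_mono: "i \<le> j \<Longrightarrow> cum \<gamma> i \<le> cum \<gamma> j"
  unfolding cum_def by (rule sum_mono2) auto

lemma cum_upd_Suc: "cum (\<gamma>(a := Suc (\<gamma> a))) i = cum \<gamma> i + (if a \<le> i then 1 else 0)"
  unfolding cum_def by (induction i) auto

lemma cum_upd_pred:
  "0 < \<gamma> t \<Longrightarrow> cum (\<gamma>(t := \<gamma> t - 1)) i = cum \<gamma> i - (if t \<le> i then 1 else 0)"
proof (induction i)
  case (Suc i)
  have "\<gamma> t \<le> cum \<gamma> i" if "t \<le> i"
    unfolding cum_def using that by (intro member_le_sum) auto
  with Suc show ?case by (auto simp: cum_def)
qed (auto simp: cum_def)

lemma letter_act_vecs:
  assumes "\<gamma> \<in> vecs k" "a \<in> alphabet k"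
  shows "letter_act k \<gamma> a \<in> vecs k"
  using assms by (auto simp: letter_act_def vecs_def Let_def)

text \<open>Adding a unit at \<open>a\<close> and removing one at the next positive entry
  \<open>t\<close> raises the partial sums by 1 exactly from \<open>a\<close> to
  \<open>t - 1\<close>. There they equal \<open>cum \<gamma> a\<close>, and from \<open>t\<close> on
  they already exceed it, which is what the maximum expresses.\<close>

lemma cum_letter_act:
  assumes "\<gamma> \<in> vecs k"
  shows "cum (letter_act k \<gamma> a) i = (if i < a then cum \<gamma> i else max (cum \<gamma> i) (Suc (cum \<gamma> a)))"
proof -
  define S where "S = {s \<in> alphabet k. a < s \<and> 0 < \<gamma> s}"
  have S_iff: "s \<in> S \<longleftrightarrow> a < s \<and> 0 < \<gamma> s" for s
    using assms by (auto simp: S_def vecs_def)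
  have "finite S" unfolding S_def alphabet_def by simp
  \<comment> \<open>Up to the next positive entry after \<open>a\<close> the partial sums stay
    constant.\<close>
  have const: "cum \<gamma> i = cum \<gamma> a" if "a \<le> i" "\<And>s. s \<in> S \<Longrightarrow> i < s" for i
    unfolding cum_def using that
    by (intro sum.mono_neutral_right) (auto simp: S_iff not_le, meson S_iff not_gr_zero not_le)
  show ?thesis
  proof (cases "S = {}")
    case True
    then show ?thesis
      using const[of i] by (auto simp: letter_act_def S_def[symmetric] cum_upd_Suc)
  next
    case False
    define t where "t = Min S"
    have t: "t \<in> S" "\<And>s. s \<in> S \<Longrightarrow> t \<le> s"
      using False \<open>finite S\<close> by (auto simp: t_def)
    have at: "a < t" "0 < \<gamma> t" using t(1) S_iff by auto
    \<comment> \<open>The simultaneous update is split into two successive ones, to which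
      \<open>cum_upd_Suc\<close> and \<open>cum_upd_pred\<close> apply.\<close>
    have act: "letter_act k \<gamma> a = (\<gamma>(a := Suc (\<gamma> a)))(t := (\<gamma>(a := Suc (\<gamma> a))) t - 1)"
      using False at by (simp add: letter_act_def S_def[symmetric] t_def[symmetric] Let_def)
    have cum_act: "cum (letter_act k \<gamma> a) i
        = cum \<gamma> i + (if a \<le> i then 1 else 0) - (if t \<le> i then 1 else 0)"
      unfolding act using at by (subst cum_upd_pred) (auto simp: cum_upd_Suc)
    have "Suc (cum \<gamma> a) \<le> cum \<gamma> i" if "t \<le> i"
    proof -
      have "Suc (cum \<gamma> a) \<le> cum \<gamma> (t - 1) + \<gamma> t"
        using cum_mono[of a "t - 1" \<gamma>] at by linarith
      also have "\<dots> = cum \<gamma> t" using at by (cases t) (auto simp: cum_def)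
      finally show ?thesis using cum_mono[OF that, of \<gamma>] by simp
    qed
    moreover have "cum \<gamma> i = cum \<gamma> a" if "a \<le> i" "i < t"
      using const[of i] t(2) that by fastforce
    ultimately show ?thesis unfolding cum_act using at by auto
  qed
qed

lemma word_act_snoc: "word_act k \<gamma> (u @ [a]) = letter_act k (word_act k \<gamma> u) a"
  by (simp add: word_act_def)

lemma word_act_vecs:
  assumes "\<gamma> \<in> vecs k" "u \<in> words k"
  shows "word_act k \<gamma> u \<in> vecs k"
  using assms(2)
proof (induction u rule: rev_induct)
  case Nil
  then show ?case using assms(1) by (simp add: word_act_def)
next
  case (snoc a u)
  then show ?case by (simp add: word_act_snoc letter_act_vecs words_def)
qed

text \<open>Induction on the last letter \<open>a\<close>: the maximum in
  \<open>cum_letter_act\<close> matches the alternative in \<open>le_lnds_snoc\<close>, with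
  intervals ending at \<open>a\<close> feeding those ending at \<open>i\<close>. Hence
  \<open>m\<close> and \<open>i\<close> are generalised.\<close>

lemma le_cum_word_act:
  assumes "\<gamma> \<in> vecs k" "u \<in> words k"
  shows "m \<le> cum (word_act k \<gamma> u) i \<longleftrightarrow> (\<exists>j\<le>i. m \<le> cum \<gamma> j + lnds {j..i} u)"
  using assms(2)
proof (induction u arbitrary: m i rule: rev_induct)
  case Nil
  have "lnds S [] = 0" for S using lnds_le_length[of S "[]"] by simp
  then show ?case
    using cum_mono[of _ i \<gamma>] by (auto simp: word_act_def intro: order_trans)
next
  case (snoc a u)
  let ?g = "word_act k \<gamma> u"
  have u: "u \<in> words k" using snoc.prems by (simp add: words_def)
  note IH = snoc.IH[OF u]
  have g: "?g \<in> vecs k" using word_act_vecs[OF assms(1) u] .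
  have snoc_lnds: "m \<le> c + lnds {j..i} (u @ [a]) \<longleftrightarrow>
      m \<le> c + lnds {j..i} u \<or> (j \<le> a \<and> a \<le> i \<and> m \<le> Suc (c + lnds {j..a} u))" for c j
  proof -
    have "{j..i} \<inter> {..a} = {j..a}" if "a \<le> i" using that by auto
    then show ?thesis
      using le_lnds_snoc[of "m - c" "{j..i}" u a] by auto
  qed
  have "m \<le> cum (word_act k \<gamma> (u @ [a])) i \<longleftrightarrow>
      m \<le> cum ?g i \<or> (a \<le> i \<and> m - 1 \<le> cum ?g a)"
    unfolding word_act_snoc cum_letter_act[OF g] by auto
  also have "\<dots> \<longleftrightarrow> (\<exists>j\<le>i. m \<le> cum \<gamma> j + lnds {j..i} u) \<or>
      (a \<le> i \<and> (\<exists>j\<le>a. m - 1 \<le> cum \<gamma> j + lnds {j..a} u))"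
    unfolding IH ..
  also have "\<dots> \<longleftrightarrow> (\<exists>j\<le>i. m \<le> cum \<gamma> j + lnds {j..i} (u @ [a]))"
    unfolding snoc_lnds by (simp add: le_diff_conv) (meson order_trans)
  finally show ?case .
qed

section \<open>Congruence via intervals\<close>

text \<open>No rank is mentioned, so words and their standardisations, which live over different
  alphabets, are treated by the same relation.\<close>

definition interval_eq :: "nat list \<Rightarrow> nat list \<Rightarrow> bool" where
  "interval_eq u v \<longleftrightarrow> (\<forall>a b. lnds {a..b} u = lnds {a..b} v)"

lemma lnds_eq_if_gram_cong:
  assumes "gram_cong k u v"
  shows "lnds {a..b} u = lnds {a..b} v"
proof -
  have uv: "u \<in> words k" "v \<in> words k"
    and eq: "\<And>\<gamma>. \<gamma> \<in> vecs k \<Longrightarrow> word_act k \<gamma> u = word_act k \<gamma> v"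
    using assms by (auto simp: gram_cong_def)
  define M where "M = length u + length v"
  consider "b < a" | "k < a" | "a = 0" | "a \<in> alphabet k" "a \<le> b"
    by (force simp: alphabet_def)
  then show ?thesis
  proof cases
    case 1
    then show ?thesis by simp
  next
    case 2
    then have "lnds {a..b} w = lnds {} w" if "w \<in> words k" for w
      using that by (intro lnds_cong) (auto simp: words_def alphabet_def)
    then show ?thesis using uv by simp
  next
    \<comment> \<open>No vector of \<open>vecs k\<close> is positive at 0. The zero vector serves
      instead: all \<open>j\<close> then compete with offset 0, and \<open>{0..b}\<close> wins by
      monotonicity.\<close>
    case 3
    have zero: "(\<lambda>_. 0) \<in> vecs k" by (simp add: vecs_def)
    have "m \<le> lnds {0..b} w \<longleftrightarrow> m \<le> cum (word_act k (\<lambda>_. 0) w) b"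
      if w: "w \<in> words k" for m w
    proof -
      have "lnds {j..b} w \<le> lnds {0..b} w" for j by (rule lnds_mono) auto
      then show ?thesis
        unfolding le_cum_word_act[OF zero w] by (auto simp: cum_def intro: order_trans)
    qed
    then show ?thesis using uv eq[OF zero] 3 by (intro eq_by_le_iff) simp
  next
    case 4
    \<comment> \<open>As \<open>M\<close> bounds all lengths, subsequences using a letter below \<open>a\<close> cannot win.\<close>
    define \<gamma> where "\<gamma> = (\<lambda>i. if i = a then M else 0)"
    have \<gamma>: "\<gamma> \<in> vecs k" using 4 by (auto simp: \<gamma>_def vecs_def)
    have cum\<gamma>: "cum \<gamma> j = (if a \<le> j then M else 0)" for j
      by (simp add: cum_def \<gamma>_def)
    have "M + m \<le> cum (word_act k \<gamma> w) b \<longleftrightarrow> m \<le> lnds {a..b} w"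
      if w: "w \<in> words k" "length w \<le> M" for m w
    proof
      assume "M + m \<le> cum (word_act k \<gamma> w) b"
      then obtain j where j: "j \<le> b" "M + m \<le> cum \<gamma> j + lnds {j..b} w"
        using le_cum_word_act[OF \<gamma> w(1)] by blast
      show "m \<le> lnds {a..b} w"
      proof (cases "a \<le> j")
        case True
        then have "lnds {j..b} w \<le> lnds {a..b} w" by (intro lnds_mono) auto
        then show ?thesis using j True by (simp add: cum\<gamma>)
      next
        case False
        then show ?thesis using j lnds_le_length[of "{j..b}" w] w by (simp add: cum\<gamma>)
      qed
    next
      assume "m \<le> lnds {a..b} w"
      then show "M + m \<le> cum (word_act k \<gamma> w) b"
        unfolding le_cum_word_act[OF \<gamma> w(1)] using 4(2) by (intro exI[of _ a]) (simp add: cum\<gamma>)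
    qed
    note this[OF uv(1)] this[OF uv(2)]
    then show ?thesis using eq[OF \<gamma>] by (intro eq_by_le_iff) (simp add: M_def)
  qed
qed

lemma gram_cong_iff:
  "gram_cong k u v \<longleftrightarrow> u \<in> words k \<and> v \<in> words k \<and> interval_eq u v"
proof -
  have "gram_cong k u v" if uv: "u \<in> words k" "v \<in> words k" and "interval_eq u v"
    unfolding gram_cong_def
  proof (intro conjI ballI uv cum_eqD eq_by_le_iff)
    fix \<gamma> i m
    assume "\<gamma> \<in> vecs k"
    then show "m \<le> cum (word_act k \<gamma> u) i \<longleftrightarrow> m \<le> cum (word_act k \<gamma> v) i"
      using that by (simp add: le_cum_word_act interval_eq_def)
  qed
  then show ?thesis
    using lnds_eq_if_gram_cong unfolding interval_eq_def gram_cong_def by blast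
qed

text \<open>A set convex relative to the finite letter set \<open>Z\<close> agrees on
  \<open>Z\<close> with the interval from its least to its greatest letter. Its shape outside
  \<open>Z\<close> is irrelevant, which suits preimages under maps monotone only on
  \<open>Z\<close>.\<close>

lemma lnds_convex_eq:
  assumes eq: "interval_eq u v" and Z: "set u \<subseteq> Z" "set v \<subseteq> Z" "finite Z"
    and conv: "\<And>x y z. x \<in> S \<inter> Z \<Longrightarrow> y \<in> S \<inter> Z \<Longrightarrow> z \<in> Z \<Longrightarrow> x \<le> z \<Longrightarrow> z \<le> y \<Longrightarrow> z \<in> S"
  shows "lnds S u = lnds S v"
proof (cases "S \<inter> Z = {}")
  case True
  then have "lnds S w = lnds {} w" if "set w \<subseteq> Z" for w
    using that by (intro lnds_cong) auto
  then show ?thesis using Z by simp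
next
  case False
  have fin: "finite (S \<inter> Z)" using Z(3) by simp
  have "S \<inter> Z = {Min (S \<inter> Z)..Max (S \<inter> Z)} \<inter> Z"
  proof (intro equalityI subsetI)
    fix z assume "z \<in> S \<inter> Z"
    then show "z \<in> {Min (S \<inter> Z)..Max (S \<inter> Z)} \<inter> Z"
      using fin by simp
  next
    fix z assume "z \<in> {Min (S \<inter> Z)..Max (S \<inter> Z)} \<inter> Z"
    then show "z \<in> S \<inter> Z"
      using conv[OF Min_in[OF fin False] Max_in[OF fin False], of z] by simp
  qed
  then have "lnds S w = lnds {Min (S \<inter> Z)..Max (S \<inter> Z)} w" if "set w \<subseteq> Z" for w
    using that by (intro lnds_cong) blast
  then show ?thesis using Z eq by (simp add: interval_eq_def)
qed

text \<open>Preimages of intervals under a map monotone on \<open>Z\<close> are convex in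
  \<open>Z\<close>.\<close>

lemma interval_eq_map:
  assumes eq: "interval_eq u v" and Z: "set u \<subseteq> Z" "set v \<subseteq> Z" "finite Z"
    and mono: "mono_on Z g"
    and ties: "sorted_wrt (\<lambda>x y. g x = g y \<longrightarrow> x \<le> y) u"
      "sorted_wrt (\<lambda>x y. g x = g y \<longrightarrow> x \<le> y) v"
  shows "interval_eq (map g u) (map g v)"
  unfolding interval_eq_def
proof (intro allI)
  fix a b
  have "lnds (g -` {a..b}) u = lnds (g -` {a..b}) v"
  proof (rule lnds_convex_eq[OF eq Z])
    fix x y z
    assume "x \<in> g -` {a..b} \<inter> Z" "y \<in> g -` {a..b} \<inter> Z" "z \<in> Z" "x \<le> z" "z \<le> y"
    then show "z \<in> g -` {a..b}"
      using mono_onD[OF mono, of x z] mono_onD[OF mono, of z y] by simp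
  qed
  then show "lnds {a..b} (map g u) = lnds {a..b} (map g v)"
    using lnds_map mono_on_subset[OF mono] Z ties by simp
qed

text \<open>Singletons are intervals, so the interval lengths determine the content.\<close>

lemma count_list_eq_if_interval_eq: "interval_eq u v \<Longrightarrow> count_list u = count_list v"
  using lnds_singleton by (metis atLeastAtMost_singleton ext interval_eq_def)

lemma set_eq_if_count_list_eq: "count_list u = count_list v \<Longrightarrow> set u = set v"
  by (metis count_list_0_iff subsetI subset_antisym)

lemma content_eq_iff:
  assumes "u \<in> words n" "v \<in> words n"
  shows "content n u = content n v \<longleftrightarrow> count_list u = count_list v"
proof
  assume eq: "content n u = content n v"
  show "count_list u = count_list v"
  proof
    fix a
    show "count_list u a = count_list v a"
    proof (cases "a \<in> alphabet n")
      case True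
      then show ?thesis using fun_cong[OF eq, of a] by (simp add: content_def)
    next
      case False
      then have "a \<notin> set u" "a \<notin> set v" using assms by (auto simp: words_def)
      then show ?thesis by simp
    qed
  qed
qed (simp add: content_def)

section \<open>Restriction to subintervals\<close>

lemma gram_cong_restr_iff:
  assumes "u \<in> words n" "v \<in> words n"
  shows "gram_cong n u v \<longleftrightarrow>
    (\<forall>I. subinterval n I \<longrightarrow> gram_cong n (restr_word I u) (restr_word I v))"
proof
  assume "gram_cong n u v"
  then have eq: "interval_eq u v" by (simp add: gram_cong_iff)
  show "\<forall>I. subinterval n I \<longrightarrow> gram_cong n (restr_word I u) (restr_word I v)"
  proof (intro allI impI)
    fix I assume I: "subinterval n I"
    \<comment> \<open>Filtering by \<open>I\<close> intersects each test interval with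
      \<open>I\<close>, which leaves a set convex in the alphabet.\<close>
    have "lnds {x \<in> {a..b}. x \<in> I} u = lnds {x \<in> {a..b}. x \<in> I} v" for a b
    proof (rule lnds_convex_eq[OF eq])
      show "set u \<subseteq> alphabet n" "set v \<subseteq> alphabet n" "finite (alphabet n)"
        using assms by (auto simp: words_def alphabet_def)
      fix x y z
      assume "x \<in> {x \<in> {a..b}. x \<in> I} \<inter> alphabet n" "y \<in> {x \<in> {a..b}. x \<in> I} \<inter> alphabet n"
        "z \<in> alphabet n" "x \<le> z" "z \<le> y"
      moreover from this have "z \<in> I"
        using I unfolding subinterval_def by (metis IntD1 le_neq_implies_less mem_Collect_eq)
      ultimately show "z \<in> {x \<in> {a..b}. x \<in> I}" by simp
    qed
    moreover have "restr_word I u \<in> words n" "restr_word I v \<in> words n"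
      using assms by (auto simp: restr_word_def words_def)
    ultimately show "gram_cong n (restr_word I u) (restr_word I v)"
      by (simp add: gram_cong_iff interval_eq_def restr_word_def lnds_filter)
  qed
next
  assume "\<forall>I. subinterval n I \<longrightarrow> gram_cong n (restr_word I u) (restr_word I v)"
  \<comment> \<open>For the converse the whole alphabet suffices, since restriction to it changes
    nothing.\<close>
  moreover have "subinterval n (alphabet n)" by (simp add: subinterval_def)
  moreover have "restr_word (alphabet n) w = w" if "w \<in> words n" for w
    using that by (auto simp: restr_word_def words_def intro: filter_True)
  ultimately show "gram_cong n u v" using assms by metis
qed

section \<open>Packing\<close>

lemma sorted_wrt_ties_if_inj_on:
  fixes w :: "nat list"
  assumes "inj_on g (set w)"
  shows "sorted_wrt (\<lambda>x y. g x = g y \<longrightarrow> x \<le> y) w"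
proof -
  have "w ! i \<le> w ! j" if "i < j" "j < length w" "g (w ! i) = g (w ! j)" for i j
    using inj_onD[OF assms that(3)] that by simp
  then show ?thesis by (simp add: sorted_wrt_iff_nth_less)
qed

lemma card_le_strict_mono_on:
  fixes Z :: "nat set"
  assumes "finite Z"
  shows "strict_mono_on Z (\<lambda>a. card {b \<in> Z. b \<le> a})"
proof (rule strict_mono_onI)
  fix x y assume "x \<in> Z" "y \<in> Z" "x < y"
  then have "{b \<in> Z. b \<le> x} \<subseteq> {b \<in> Z. b \<le> y}" "y \<in> {b \<in> Z. b \<le> y} - {b \<in> Z. b \<le> x}"
    by auto
  then have "{b \<in> Z. b \<le> x} \<subset> {b \<in> Z. b \<le> y}" by blast
  then show "card {b \<in> Z. b \<le> x} < card {b \<in> Z. b \<le> y}"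
    using assms by (intro psubset_card_mono) auto
qed

lemma pack_in_words:
  assumes "u \<in> words n"
  shows "pack u \<in> words n"
proof -
  have "card {b \<in> set u. b \<le> a} \<in> {1..n}" if "a \<in> set u" for a
  proof -
    have "card {b \<in> set u. b \<le> a} \<le> card {1..n}"
      using assms by (intro card_mono) (auto simp: words_def alphabet_def)
    moreover have "0 < card {b \<in> set u. b \<le> a}"
      using that by (auto simp: card_gt_0_iff)
    ultimately show ?thesis by simp
  qed
  then show ?thesis by (auto simp: pack_def words_def alphabet_def)
qed

lemma gram_cong_pack_iff:
  assumes "u \<in> words n" "v \<in> words n"
  shows "gram_cong n u v \<longleftrightarrow> gram_cong n (pack u) (pack v) \<and> content n u = content n v"
proof -
  have "interval_eq u v \<longleftrightarrow> interval_eq (pack u) (pack v)" if cnt: "count_list u = count_list v"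
  proof -
    \<comment> \<open>Equal contents give a common support \<open>Z\<close>, so both words are
      packed by one relabelling \<open>f\<close>, and its inverse \<open>g\<close> unpacks
      both.\<close>
    define Z where "Z = set u"
    define f where "f = (\<lambda>a. card {b \<in> Z. b \<le> a})"
    define g where "g = inv_into Z f"
    have Z: "set u = Z" "set v = Z" "finite Z"
      using set_eq_if_count_list_eq[OF cnt] by (auto simp: Z_def)
    have f: "strict_mono_on Z f"
      unfolding f_def using card_le_strict_mono_on[OF Z(3)] .
    have inj: "inj_on f Z" using f by (rule strict_mono_on_imp_inj_on)
    have pack: "pack u = map f u" "pack v = map f v"
      by (simp_all add: pack_def f_def Z)
    have gf: "g (f x) = x" if "x \<in> Z" for x
      using inj that by (simp add: g_def)
    have map_g: "map g (pack u) = u" "map g (pack v) = v"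
      using gf Z by (auto simp: pack intro: map_idI)
    \<comment> \<open>The values of \<open>inv_into\<close> are under control only on the image of
      \<open>Z\<close>, so monotonicity is claimed only there.\<close>
    have "mono_on (f ` Z) g"
    proof (rule mono_onI, clarify)
      fix x y assume xy: "x \<in> Z" "y \<in> Z" "f x \<le> f y"
      then have "x \<le> y" using strict_mono_onD[OF f, of y x] by force
      then show "g (f x) \<le> g (f y)" using xy gf by simp
    qed
    moreover have "inj_on g (f ` Z)"
      using gf by (intro inj_onI) auto
    ultimately have "interval_eq u v" if "interval_eq (pack u) (pack v)"
      using interval_eq_map[OF that, of "f ` Z" g] Z sorted_wrt_ties_if_inj_on[of g]
      unfolding map_g by (simp add: pack)
    moreover have "interval_eq (pack u) (pack v)" if "interval_eq u v"
      using interval_eq_map[OF that, of Z f] Z f inj sorted_wrt_ties_if_inj_on[of f]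
      by (simp add: pack strict_mono_on_imp_mono_on)
    ultimately show ?thesis by blast
  qed
  then show ?thesis
    using assms pack_in_words content_eq_iff count_list_eq_if_interval_eq
    unfolding gram_cong_iff by blast
qed

section \<open>Schuetzenberger involution\<close>

lemma gram_cong_schuetzenberger_iff:
  assumes "u \<in> words n" "v \<in> words n"
  shows "gram_cong n u v \<longleftrightarrow> gram_cong n (schuetzenberger n u) (schuetzenberger n v)"
proof -
  define h where "h = (\<lambda>i. n - i + 1)"
  have sch: "schuetzenberger n w = rev (map h w)" for w
    by (simp add: schuetzenberger_def h_def)
  have "h i \<in> alphabet n" if "i \<in> alphabet n" for i
    using that by (auto simp: h_def alphabet_def)
  then have words: "schuetzenberger n w \<in> words n" if "w \<in> words n" for w
    using that unfolding sch words_def by auto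
  \<comment> \<open>Truncated subtraction makes \<open>h\<close> an involution only on the alphabet,
    hence the restriction to \<open>words n\<close>.\<close>
  have invol: "schuetzenberger n (schuetzenberger n w) = w" if "w \<in> words n" for w
  proof -
    have "map (h \<circ> h) w = w"
      using that by (intro map_idI) (auto simp: words_def alphabet_def h_def)
    then show ?thesis by (simp add: sch rev_map)
  qed
  \<comment> \<open>One implication for arbitrary words is enough: applied to the images, it gives
    the converse by \<open>invol\<close>.\<close>
  have "gram_cong n (schuetzenberger n u) (schuetzenberger n v)" if cong: "gram_cong n u v" for u v
  proof -
    have uv: "u \<in> words n" "v \<in> words n" and eq: "interval_eq u v"
      using cong by (simp_all add: gram_cong_iff)
    have Z: "set u \<subseteq> alphabet n" "set v \<subseteq> alphabet n" "finite (alphabet n)"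
      using uv by (auto simp: words_def alphabet_def)
    have "lnds {a..b} (schuetzenberger n w) = lnds (h -` {a..b}) w" if "set w \<subseteq> alphabet n" for a b w
      unfolding sch
    proof (rule lnds_rev_map)
      fix x y assume "x \<in> set w" "y \<in> set w"
      then have "x \<in> {1..n}" "y \<in> {1..n}" using that by (auto simp: alphabet_def)
      then show "h x \<le> h y \<longleftrightarrow> y \<le> x" by (auto simp: h_def)
    qed
    moreover have "lnds (h -` {a..b}) u = lnds (h -` {a..b}) v" for a b
      by (rule lnds_convex_eq[OF eq Z]) (auto simp: h_def)
    ultimately show ?thesis
      using words uv Z by (simp add: gram_cong_iff interval_eq_def)
  qed
  then show ?thesis using invol assms by metis
qed

section \<open>Standardisation\<close>

lemma subseq_append_drop_hd:
  "subseq (y # t) (p @ q) \<Longrightarrow> y \<notin> set p \<Longrightarrow> subseq (y # t) q"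
  by (induction p) (auto dest: subseq_Cons2_neq)

lemma subseq_append_drop_last:
  assumes "subseq (t @ [y]) (p @ q)" "y \<notin> set q"
  shows "subseq (t @ [y]) p"
proof -
  have "subseq (y # rev t) (rev q @ rev p)"
    using subseq_rev[OF assms(1)] by simp
  then have "subseq (y # rev t) (rev p)"
    by (rule subseq_append_drop_hd) (use assms(2) in simp)
  then show ?thesis using subseq_rev by fastforce
qed

lemma distinct_if_sorted_wrt_ties:
  fixes w :: "nat list"
  assumes "sorted_wrt (\<lambda>x y. g x = g y \<longrightarrow> x < y) w"
  shows "distinct w"
proof -
  have "w ! i \<noteq> w ! j" if "i < j" "j < length w" for i j
    using assms that unfolding sorted_wrt_iff_nth_less by fastforce
  then show ?thesis
    unfolding distinct_conv_nth by (metis linorder_neqE_nat)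
qed

lemma subseq_distinct: "subseq s u \<Longrightarrow> distinct u \<Longrightarrow> distinct s"
  unfolding subseq_conv_nths by (auto intro: distinct_nthsI)

text \<open>An optimal subsequence avoiding \<open>x\<close> either avoids the whole block \<open>g z = g x\<close> or starts inside
  it; in the latter case \<open>x\<close> can be put in front, as blocks increase from left to right.\<close>

lemma lnds_low:
  fixes g :: "nat \<Rightarrow> nat"
  assumes mono: "mono_on (set w) g"
    and ties: "sorted_wrt (\<lambda>x y. g x = g y \<longrightarrow> x < y) w"
    and x: "x \<in> set w" "x \<in> E"
  shows "lnds ({x<..} \<inter> E) w = max (lnds ({x..} \<inter> E) w - 1) (lnds ({z. g x < g z} \<inter> E) w)"
proof (rule antisym)
  obtain p q where w: "w = p @ x # q" using x(1) by (meson split_list)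
  obtain t where t: "subseq t w" "sorted t" "set t \<subseteq> {x<..} \<inter> E" "length t = lnds ({x<..} \<inter> E) w"
    by (rule obtain_lnds)
  have sub: "set t \<subseteq> set w" using list_emb_set[OF t(1)] by blast
  show "lnds ({x<..} \<inter> E) w \<le> max (lnds ({x..} \<inter> E) w - 1) (lnds ({z. g x < g z} \<inter> E) w)"
  proof (cases t)
    case Nil
    then show ?thesis using t(4) by simp
  next
    case (Cons y t')
    have y: "x < y" "y \<in> set w" using Cons t(3) sub by auto
    show ?thesis
    proof (cases "g x < g y")
      case True
      have "g y \<le> g z" if "z \<in> set t" for z
        using mono_onD[OF mono y(2), of z] that sub t(2) Cons by auto
      then have "set t \<subseteq> {z. g x < g z} \<inter> E" using t(3) True order_less_le_trans by blast
      then show ?thesis using length_le_lnds[OF t(1,2)] t(4) by (metis max.coboundedI2)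
    next
      case False
      then have "g x = g y" using mono_onD[OF mono x(1) y(2)] y(1) by simp
      \<comment> \<open>\<open>y\<close> lies in the block of \<open>x\<close> and exceeds
        \<open>x\<close>, so it occurs to the right of \<open>x\<close>.\<close>
      then have "y \<notin> set p" using ties y(1) by (auto simp: w sorted_wrt_append)
      then have "subseq (y # t') (x # q)"
        using subseq_append_drop_hd t(1) by (metis Cons w)
      then have "subseq (x # t) w"
        using y(1) by (auto simp: w Cons intro: subseq_drop_many dest: subseq_Cons2_neq)
      moreover have "sorted (x # t)" using t(2,3) by (auto intro: less_imp_le)
      moreover have "set (x # t) \<subseteq> {x..} \<inter> E" using t(3) x(2) by auto
      ultimately have "length (x # t) \<le> lnds ({x..} \<inter> E) w" by (rule length_le_lnds)
      then show ?thesis using t(4) by simp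
    qed
  qed
next
  have "distinct w" using ties by (rule distinct_if_sorted_wrt_ties)
  obtain t where t: "subseq t w" "sorted t" "set t \<subseteq> {x..} \<inter> E" "length t = lnds ({x..} \<inter> E) w"
    by (rule obtain_lnds)
  have "distinct t" using t(1) \<open>distinct w\<close> by (rule subseq_distinct)
  \<comment> \<open>Dropping the first letter of an optimal subsequence costs one; as
    \<open>t\<close> is distinct, the rest lies strictly above \<open>x\<close>.\<close>
  have "lnds ({x..} \<inter> E) w - 1 \<le> lnds ({x<..} \<inter> E) w"
  proof (cases t)
    case Nil
    then show ?thesis using t(4) by simp
  next
    case (Cons y t')
    have "set t' \<subseteq> {x<..} \<inter> E"
    proof
      fix z assume "z \<in> set t'"
      then have "z \<in> E" "x \<le> y" "y \<le> z" "y \<noteq> z"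
        using t(2,3) Cons \<open>distinct t\<close> by auto
      then show "z \<in> {x<..} \<inter> E" by simp
    qed
    moreover have "subseq t' w" "sorted t'" using t(1,2) Cons by (auto dest: subseq_Cons')
    ultimately have "length t' \<le> lnds ({x<..} \<inter> E) w" using length_le_lnds by blast
    then show ?thesis using t(4) Cons by simp
  qed
  moreover have "lnds ({z. g x < g z} \<inter> E) w \<le> lnds ({x<..} \<inter> E) w"
  proof (rule lnds_mono, rule subsetI)
    fix z assume "z \<in> {z. g x < g z} \<inter> E \<inter> set w"
    then show "z \<in> {x<..} \<inter> E"
      using mono_onD[OF mono _ x(1), of z] by (cases "z \<le> x") auto
  qed
  ultimately show "max (lnds ({x..} \<inter> E) w - 1) (lnds ({z. g x < g z} \<inter> E) w) \<le> lnds ({x<..} \<inter> E) w"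
    by simp
qed

text \<open>Mirror image of \<open>lnds_low\<close>: an optimal subsequence that ends inside the
  block of \<open>x\<close> ends to the left of \<open>x\<close> and can be extended by
  \<open>x\<close>.\<close>

lemma lnds_high:
  fixes g :: "nat \<Rightarrow> nat"
  assumes mono: "mono_on (set w) g"
    and ties: "sorted_wrt (\<lambda>x y. g x = g y \<longrightarrow> x < y) w"
    and x: "x \<in> set w" "x \<in> D"
  shows "lnds (D \<inter> {..<x}) w = max (lnds (D \<inter> {..x}) w - 1) (lnds (D \<inter> {z. g z < g x}) w)"
proof (rule antisym)
  obtain p q where w: "w = p @ x # q" using x(1) by (meson split_list)
  obtain t where t: "subseq t w" "sorted t" "set t \<subseteq> D \<inter> {..<x}" "length t = lnds (D \<inter> {..<x}) w"
    by (rule obtain_lnds)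
  have sub: "set t \<subseteq> set w" using list_emb_set[OF t(1)] by blast
  show "lnds (D \<inter> {..<x}) w \<le> max (lnds (D \<inter> {..x}) w - 1) (lnds (D \<inter> {z. g z < g x}) w)"
  proof (cases t rule: rev_cases)
    case Nil
    then show ?thesis using t(4) by simp
  next
    case (snoc t' y)
    have y: "y < x" "y \<in> set w" using snoc t(3) sub by auto
    show ?thesis
    proof (cases "g y < g x")
      case True
      have "g z \<le> g y" if "z \<in> set t" for z
        using mono_onD[OF mono _ y(2), of z] that sub t(2) snoc by (auto simp: sorted_append)
      then have "set t \<subseteq> D \<inter> {z. g z < g x}" using t(3) True order_le_less_trans by blast
      then show ?thesis using length_le_lnds[OF t(1,2)] t(4) by (metis max.coboundedI2)
    next
      case False
      then have "g y = g x" using mono_onD[OF mono y(2) x(1)] y(1) by simp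
      then have "y \<notin> set (x # q)" using ties y(1) by (auto simp: w sorted_wrt_append)
      then have "subseq t p"
        using subseq_append_drop_last t(1) by (metis snoc w)
      then have "subseq (t @ [x]) w"
        unfolding w by (intro list_emb_append_mono) auto
      moreover have "sorted (t @ [x])" using t(2,3) by (auto simp: sorted_append intro: less_imp_le)
      moreover have "set (t @ [x]) \<subseteq> D \<inter> {..x}" using t(3) x(2) by auto
      ultimately have "length (t @ [x]) \<le> lnds (D \<inter> {..x}) w" by (rule length_le_lnds)
      then show ?thesis using t(4) by simp
    qed
  qed
next
  have "distinct w" using ties by (rule distinct_if_sorted_wrt_ties)
  obtain t where t: "subseq t w" "sorted t" "set t \<subseteq> D \<inter> {..x}" "length t = lnds (D \<inter> {..x}) w"
    by (rule obtain_lnds)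
  have "distinct t" using t(1) \<open>distinct w\<close> by (rule subseq_distinct)
  have "lnds (D \<inter> {..x}) w - 1 \<le> lnds (D \<inter> {..<x}) w"
  proof (cases t rule: rev_cases)
    case Nil
    then show ?thesis using t(4) by simp
  next
    case (snoc t' y)
    have "set t' \<subseteq> D \<inter> {..<x}"
    proof
      fix z assume "z \<in> set t'"
      then have "z \<in> D" "y \<le> x" "z \<le> y" "y \<noteq> z"
        using t(2,3) snoc \<open>distinct t\<close> by (auto simp: sorted_append)
      then show "z \<in> D \<inter> {..<x}" by simp
    qed
    moreover have "subseq t' w"
      using t(1) snoc subseq_order.trans subseq_rev_drop_many by blast
    moreover have "sorted t'" using t(2) snoc by (simp add: sorted_append)
    ultimately have "length t' \<le> lnds (D \<inter> {..<x}) w" using length_le_lnds by blast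
    then show ?thesis using t(4) snoc by simp
  qed
  moreover have "lnds (D \<inter> {z. g z < g x}) w \<le> lnds (D \<inter> {..<x}) w"
  proof (rule lnds_mono, rule subsetI)
    fix z assume z: "z \<in> D \<inter> {z. g z < g x} \<inter> set w"
    then show "z \<in> D \<inter> {..<x}"
      using mono_onD[OF mono x(1), of z] by (cases "x \<le> z") auto
  qed
  ultimately show "max (lnds (D \<inter> {..x}) w - 1) (lnds (D \<inter> {z. g z < g x}) w) \<le> lnds (D \<inter> {..<x}) w"
    by simp
qed

text \<open>Starting from unions of blocks, first the lower and then the upper end of the interval
  is moved one letter at a time. Each move is governed by \<open>lnds_low\<close> or
  \<open>lnds_high\<close>, whose other terms are already known to agree.\<close>

lemma interval_eq_if_block_eq:
  fixes g :: "nat \<Rightarrow> nat"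
  assumes mono: "mono_on {1..k} g"
    and w: "set w = {1..k}" "sorted_wrt (\<lambda>x y. g x = g y \<longrightarrow> x < y) w"
    and w': "set w' = {1..k}" "sorted_wrt (\<lambda>x y. g x = g y \<longrightarrow> x < y) w'"
    and blocks: "\<And>a b. lnds (g -` {a..<b}) w = lnds (g -` {a..<b}) w'"
  shows "interval_eq w w'"
proof -
  note low = lnds_low[of _ g] and high = lnds_high[of _ g]
  have cong: "lnds S w = lnds S w'" if "lnds T w = lnds T w'" "S \<inter> {1..k} = T \<inter> {1..k}" for S T
    using lnds_cong[of S w T] lnds_cong[of S w' T] that w(1) w'(1) by metis
  have empty: "lnds S w = lnds S w'" if "S \<inter> {1..k} = {}" for S
    by (rule cong[of "{}"]) (use that in auto)
  \<comment> \<open>The upper end stays on a block boundary, so the higher blocks in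
    \<open>lnds_low\<close> form a union of blocks covered by \<open>blocks\<close>.\<close>
  have step1: "lnds ({j..} \<inter> g -` {..<b}) w = lnds ({j..} \<inter> g -` {..<b}) w'" for j b
  proof (induction j)
    case 0
    show ?case using blocks[of 0 b] by (simp add: atLeast0LessThan atLeast_0)
  next
    case (Suc j)
    \<comment> \<open>Only in the last case is \<open>j\<close> a letter of the set that is removed;
      otherwise nothing is removed or no letters remain.\<close>
    consider "j = 0" | "j > k" | "j \<in> {1..k}" "b \<le> g j" | "j \<in> {1..k}" "g j < b"
      by fastforce
    then show ?case
    proof cases
      case 1
      then show ?thesis by (intro cong[OF Suc.IH]) auto
    next
      case 2
      then show ?thesis by (intro empty) auto
    next
      case 3
      have "\<not> g z < b" if "z \<in> {1..k}" "j < z" for z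
        using mono_onD[OF mono 3(1) that(1)] that(2) 3(2) by simp
      then show ?thesis by (intro empty) auto
    next
      case 4
      have "{z. g j < g z} \<inter> g -` {..<b} = g -` {Suc (g j)..<b}" by auto
      moreover have "{Suc j..} = {j<..}" by auto
      ultimately show ?thesis
        using low[of w j "g -` {..<b}"] low[of w' j "g -` {..<b}"] w w' mono 4 Suc.IH blocks
        by simp
    qed
  qed
  \<comment> \<open>Now the upper end descends from \<open>k\<close>, for any lower end. The lower
    blocks in \<open>lnds_high\<close> are covered by \<open>step1\<close>, and so is the base case,
    where all letters lie below the bound \<open>Suc (g k)\<close>.\<close>
  have step2: "lnds ({j..} \<inter> {..i}) w = lnds ({j..} \<inter> {..i}) w'" for i j
  proof (induction "k - i" arbitrary: i)
    case 0
    have "g z < Suc (g k)" if "z \<in> {1..k}" for z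
      using mono_onD[OF mono that, of k] that by simp
    then show ?case
      using 0 by (intro cong[OF step1[of j "Suc (g k)"]]) auto
  next
    case (Suc d)
    have x: "Suc i \<in> {1..k}" using Suc.hyps(2) by simp
    have IH: "lnds ({j..} \<inter> {..Suc i}) w = lnds ({j..} \<inter> {..Suc i}) w'"
      using Suc.hyps by (intro Suc.hyps(1)) simp
    show ?case
    proof (cases "j \<le> Suc i")
      case True
      have "{z. g z < g (Suc i)} = g -` {..<g (Suc i)}" "{..i} = {..<Suc i}" by auto
      then show ?thesis
        using high[of w "Suc i" "{j..}"] high[of w' "Suc i" "{j..}"] w w' mono x True IH step1
        by simp
    next
      case False
      then show ?thesis by (intro empty) auto
    qed
  qed
  have "{a..b} = {a..} \<inter> {..b}" for a b :: nat by auto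
  then show ?thesis unfolding interval_eq_def using step2 by simp
qed

section \<open>From the standardisation back to the word\<close>

text \<open>With \<open>c\<close> the letter counts of \<open>u\<close>, this maps a letter of the standardisation back to the letter of
  \<open>u\<close> at the same position. It depends on the content only, so congruent words share it. For \<open>x\<close>
  exceeding the length of \<open>u\<close> the value is junk.\<close>

definition std_letter :: "(nat \<Rightarrow> nat) \<Rightarrow> nat \<Rightarrow> nat" where
  "std_letter c x = (LEAST a. x \<le> sum c {..a})"

lemma length_standardise [simp]: "length (standardise u) = length u"
  by (simp add: standardise_def)

lemma nth_standardise:
  assumes "p < length u"
  shows "standardise u ! p = count_list (take (Suc p) u) (u ! p) + sum (count_list u) {..<u ! p}"
proof -
  have "(\<Sum>b \<in> {b \<in> set u. b < u ! p}. count_list u b) = sum (count_list u) {..<u ! p}"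
    by (rule sum.mono_neutral_left) (auto simp: count_list_0_iff)
  then show ?thesis using assms by (simp add: standardise_def)
qed

lemma count_list_take_le: "count_list (take p u) a \<le> count_list u a"
  by (metis append_take_drop_id count_list_append le_add1)

lemma count_list_take_Suc:
  "p < length u \<Longrightarrow> count_list (take (Suc p) u) (u ! p) = Suc (count_list (take p u) (u ! p))"
  by (simp add: take_Suc_conv_app_nth)

text \<open>The copies of a letter \<open>a\<close> are numbered strictly above the count sum over
  \<open>{..<a}\<close> and at most up to that over \<open>{..a}\<close>, so \<open>a\<close> is the
  least bound.\<close>

lemma std_letter_nth_standardise:
  assumes "p < length u"
  shows "std_letter (count_list u) (standardise u ! p) = u ! p"
  unfolding std_letter_def
proof (rule Least_equality)
  show "standardise u ! p \<le> sum (count_list u) {..u ! p}"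
    using count_list_take_le[of "Suc p" u "u ! p"]
    by (simp add: nth_standardise[OF assms] lessThan_Suc_atMost[symmetric])
next
  fix b assume b: "standardise u ! p \<le> sum (count_list u) {..b}"
  show "u ! p \<le> b"
  proof (rule ccontr)
    assume "\<not> u ! p \<le> b"
    then have "sum (count_list u) {..b} \<le> sum (count_list u) {..<u ! p}"
      by (intro sum_mono2) auto
    then show False
      using b by (simp add: nth_standardise[OF assms] count_list_take_Suc[OF assms])
  qed
qed

lemma map_std_letter_standardise: "map (std_letter (count_list u)) (standardise u) = u"
  by (rule nth_equalityI) (simp_all add: std_letter_nth_standardise)

text \<open>Equal images mean equal letters of \<open>u\<close>, whose running counts grow from left
  to right.\<close>

lemma sorted_wrt_standardise:
  "sorted_wrt (\<lambda>x y. std_letter (count_list u) x = std_letter (count_list u) y \<longrightarrow> x < y) (standardise u)"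
  unfolding sorted_wrt_iff_nth_less
proof (intro allI impI)
  fix p q
  assume pq: "p < q" "q < length (standardise u)"
    and "std_letter (count_list u) (standardise u ! p) = std_letter (count_list u) (standardise u ! q)"
  then have eq: "u ! p = u ! q" by (simp add: std_letter_nth_standardise)
  have "count_list (take (Suc p) u) (u ! q) \<le> count_list (take q u) (u ! q)"
    using count_list_take_le[of "Suc p" "take q u"] pq by (simp add: min_absorb1)
  then show "standardise u ! p < standardise u ! q"
    using pq by (simp add: nth_standardise eq count_list_take_Suc)
qed

lemma sum_count_list_atMost:
  fixes a :: nat
  assumes "set u \<subseteq> {..a}"
  shows "sum (count_list u) {..a} = length u"
  using assms by (simp add: sum_count_set)

text \<open>The entries are in range, and distinct by \<open>sorted_wrt_standardise\<close>, so
  counting suffices.\<close>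

lemma set_standardise: "set (standardise u) = {1..length u}"
proof (rule card_subset_eq)
  show "set (standardise u) \<subseteq> {1..length u}"
  proof
    fix x assume "x \<in> set (standardise u)"
    then obtain p where p: "p < length u" "x = standardise u ! p"
      by (metis in_set_conv_nth length_standardise)
    have "count_list (take (Suc p) u) (u ! p) + sum (count_list u) {..<u ! p} \<le> sum (count_list u) {..u ! p}"
      using count_list_take_le[of "Suc p" u "u ! p"] by (simp add: lessThan_Suc_atMost[symmetric])
    also have "\<dots> \<le> sum (count_list u) {..Max (set u)}"
      using p(1) by (intro sum_mono2) auto
    also have "\<dots> = length u" by (rule sum_count_list_atMost) auto
    finally show "x \<in> {1..length u}"
      using p by (simp add: nth_standardise count_list_take_Suc)
  qed
  show "card (set (standardise u)) = card {1..length u}"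
    using distinct_card[OF distinct_if_sorted_wrt_ties[OF sorted_wrt_standardise]] by simp
qed simp

text \<open>Up to \<open>length u\<close> the \<open>LEAST\<close> is attained, with
  \<open>Max (set u)\<close> as witness, and a bound for \<open>y\<close> also bounds every smaller
  \<open>x\<close>.\<close>

lemma mono_on_std_letter: "mono_on {1..length u} (std_letter (count_list u))"
proof (rule mono_onI)
  fix x y assume "y \<in> {1..length u}" "x \<le> y"
  moreover have "sum (count_list u) {..Max (set u)} = length u"
    by (rule sum_count_list_atMost) auto
  ultimately have "y \<le> sum (count_list u) {..Max (set u)}" by simp
  then have "y \<le> sum (count_list u) {..std_letter (count_list u) y}"
    unfolding std_letter_def by (rule LeastI)
  then show "std_letter (count_list u) x \<le> std_letter (count_list u) y"
    unfolding std_letter_def[of _ x] using \<open>x \<le> y\<close> by (intro Least_le) simp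
qed

lemma standardise_in_words: "standardise u \<in> words (length u)"
  using set_standardise by (auto simp: words_def alphabet_def)

lemma length_eq_if_count_list_eq:
  assumes "count_list u = count_list v"
  shows "length u = length v"
  by (metis assms set_eq_if_count_list_eq sum_count_set order_refl finite_set)

text \<open>Equal contents give both standardisations the same map \<open>g\<close> back to the
  words. Applying \<open>g\<close> yields one direction; for the other, preimages of intervals under
  \<open>g\<close> are the unions of blocks needed in
  \<open>interval_eq_if_block_eq\<close>.\<close>

lemma interval_eq_standardise_iff:
  assumes cnt: "count_list u = count_list v"
  shows "interval_eq (standardise u) (standardise v) \<longleftrightarrow> interval_eq u v"
proof
  define g where "g = std_letter (count_list u)"
  define k where "k = length u"
  have k: "length v = k" using length_eq_if_count_list_eq[OF cnt] by (simp add: k_def)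
  have map_g: "map g (standardise u) = u" "map g (standardise v) = v"
    using map_std_letter_standardise[of u] map_std_letter_standardise[of v] by (simp_all add: g_def cnt)
  have set: "set (standardise u) = {1..k}" "set (standardise v) = {1..k}"
    by (simp_all add: set_standardise k k_def[symmetric])
  have mono: "mono_on {1..k} g"
    using mono_on_std_letter[of u] by (simp add: g_def k_def)
  have strict: "sorted_wrt (\<lambda>x y. g x = g y \<longrightarrow> x < y) (standardise u)"
    "sorted_wrt (\<lambda>x y. g x = g y \<longrightarrow> x < y) (standardise v)"
    using sorted_wrt_standardise[of u] sorted_wrt_standardise[of v] by (simp_all add: g_def cnt)
  have ties: "sorted_wrt (\<lambda>x y. g x = g y \<longrightarrow> x \<le> y) (standardise u)"
    "sorted_wrt (\<lambda>x y. g x = g y \<longrightarrow> x \<le> y) (standardise v)"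
    using strict by (auto elim: sorted_wrt_mono_rel[rotated])
  {
    assume "interval_eq (standardise u) (standardise v)"
    then have "interval_eq (map g (standardise u)) (map g (standardise v))"
      by (rule interval_eq_map[where Z = "{1..k}"]) (use set mono ties in auto)
    then show "interval_eq u v" by (simp only: map_g)
  next
    assume eq: "interval_eq u v"
    show "interval_eq (standardise u) (standardise v)"
    proof (rule interval_eq_if_block_eq[OF mono set(1) strict(1) set(2) strict(2)])
      fix a b
      have "lnds {a..<b} u = lnds {a..<b} v"
        by (rule lnds_convex_eq[OF eq, of "set u \<union> set v"]) auto
      then show "lnds (g -` {a..<b}) (standardise u) = lnds (g -` {a..<b}) (standardise v)"
        using lnds_map[of "standardise u" g "{a..<b}"] lnds_map[of "standardise v" g "{a..<b}"]
          mono set ties map_g by simp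
    qed
  }
qed

text \<open>Either side forces equal contents and hence equal lengths, which supplies the common
  \<open>k\<close>.\<close>

lemma gram_cong_standardise_iff:
  assumes "u \<in> words n" "v \<in> words n"
  shows "gram_cong n u v \<longleftrightarrow> content n u = content n v \<and>
    (\<exists>k. k = length u \<and> k = length v \<and> gram_cong k (standardise u) (standardise v))"
  using assms standardise_in_words[of u] standardise_in_words[of v]
    content_eq_iff[OF assms] count_list_eq_if_interval_eq[of u v]
    length_eq_if_count_list_eq[of u v] interval_eq_standardise_iff[of u v]
  unfolding gram_cong_iff by metis

theorem proposition5p1:
  fixes n :: nat and u v :: "nat list"
  assumes "n \<ge> 1" and "u \<in> words n" and "v \<in> words n"
  shows "(gram_cong n u v \<longleftrightarrow>
            (\<forall>I. subinterval n I \<longrightarrow> gram_cong n (restr_word I u) (restr_word I v)))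
       \<and> (gram_cong n u v \<longleftrightarrow>
            gram_cong n (pack u) (pack v) \<and> content n u = content n v)
       \<and> (gram_cong n u v \<longleftrightarrow>
            content n u = content n v \<and>
            (\<exists>k. k = length u \<and> k = length v \<and> gram_cong k (standardise u) (standardise v)))
       \<and> (gram_cong n u v \<longleftrightarrow>
            gram_cong n (schuetzenberger n u) (schuetzenberger n v))"
  by (intro conjI gram_cong_restr_iff gram_cong_pack_iff gram_cong_standardise_iff
      gram_cong_schuetzenberger_iff assms)

end
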